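(* There is a $3$-connected non-complete planar graph which is not $7$-truncated-degree-choosable.
   Context: For a graph $G$ and a positive integer $k$, $G$ is $k$-truncated-degree-choosable if it is $f$-choosable for $f(v)=\min\{k,d_G(v)\}$, i.e., for every assignment of lists $L(v)$ of colours with $|L(v)|\ge \min\{k,d_G(v)\}$ for each vertex $v$, there is a proper colouring $\phi$ of $G$ with $\phi(v)\in L(v)$ for all $v$. *)

theory Defs
  imports "HOL-Analysis.Analysis" "Graph_Theory.Graph_Theory"
begin

text \<open>Finite simple graphs are the symmetric digraphs of the locale \<^locale>\<open>graph\<close>. Each
  undirected edge \<open>{u, v}\<close> is represented by the two opposite arcs \<open>(u, v)\<close> and \<open>(v, u)\<close>, so
  the degree of \<open>v\<close> is its \<^const>\<open>out_degree\<close>.\<close>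

definition edges :: "('a, 'b) pre_digraph \<Rightarrow> 'a set set" where
  "edges G = {{u, v} | u v. u \<rightarrow>\<^bsub>G\<^esub> v}"

definition k_connected :: "nat \<Rightarrow> ('a, 'b) pre_digraph \<Rightarrow> bool" where
  "k_connected k G \<longleftrightarrow> card (verts G) > k \<and>
     (\<forall>S \<subseteq> verts G. card S < k \<longrightarrow> Digraph_Component.connected (G \<restriction> (verts G - S)))"

definition complete_graph :: "('a, 'b) pre_digraph \<Rightarrow> bool" where
  "complete_graph G \<longleftrightarrow> (\<exists>n. complete_digraph n G)"

text \<open>A drawing puts vertex \<open>v\<close> at the point \<open>p v\<close> and edge \<open>e\<close> along the arc \<open>\<gamma> e\<close>; the interior
  of an arc contains no vertex and no point of any other arc. The arcs are indexed by undirected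
  edges, so that the two opposite arcs of the digraph are drawn only once.\<close>

definition plane_drawing ::
    "('a, 'b) pre_digraph \<Rightarrow> ('a \<Rightarrow> complex) \<Rightarrow> ('a set \<Rightarrow> real \<Rightarrow> complex) \<Rightarrow> bool" where
  "plane_drawing G p \<gamma> \<longleftrightarrow> inj_on p (verts G) \<and>
     (\<forall>e \<in> edges G. arc (\<gamma> e) \<and> {pathstart (\<gamma> e), pathfinish (\<gamma> e)} = p ` e \<and>
        (path_image (\<gamma> e) - p ` e) \<inter> p ` verts G = {}) \<and>
     (\<forall>e \<in> edges G. \<forall>e' \<in> edges G. e \<noteq> e' \<longrightarrow>
        (path_image (\<gamma> e) - p ` e) \<inter> path_image (\<gamma> e') = {})"

definition planar :: "('a, 'b) pre_digraph \<Rightarrow> bool" where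
  "planar G \<longleftrightarrow> (\<exists>p \<gamma>. plane_drawing G p \<gamma>)"

text \<open>Finitely many finite lists only involve finitely many colours, so natural numbers suffice
  as colours. Finiteness of the lists is explicit because \<^const>\<open>card\<close> is 0 on infinite sets.\<close>

definition choosable :: "('a, 'b) pre_digraph \<Rightarrow> ('a \<Rightarrow> nat) \<Rightarrow> bool" where
  "choosable G f \<longleftrightarrow>
     (\<forall>L :: 'a \<Rightarrow> nat set. (\<forall>v \<in> verts G. finite (L v) \<and> card (L v) \<ge> f v) \<longrightarrow>
        (\<exists>\<phi>. (\<forall>v \<in> verts G. \<phi> v \<in> L v) \<and> (\<forall>u v. u \<rightarrow>\<^bsub>G\<^esub> v \<longrightarrow> \<phi> u \<noteq> \<phi> v)))"

definition truncated_degree_choosable :: "nat \<Rightarrow> ('a, 'b) pre_digraph \<Rightarrow> bool" where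
  "truncated_degree_choosable k G \<longleftrightarrow> choosable G (\<lambda>v. min k (out_degree G v))"

end

theory Submission
  imports Defs
begin

text \<open>Two apices are joined to all vertices of a long path (the spine). In each triangle formed by
  an apex \<open>a\<close> and two consecutive spine vertices \<open>x\<close>, \<open>y\<close>, insert an outer vertex adjacent to
  \<open>a\<close>, \<open>x\<close>, \<open>y\<close> and an inner vertex adjacent to \<open>x\<close>, \<open>y\<close> and the outer vertex. If the inner
  vertex has a list \<open>P\<close> of size 3 and the outer vertex has the list \<open>P \<union> {c}\<close>, then \<open>x\<close> and \<open>y\<close>
  cannot both be coloured from \<open>P\<close> once \<open>a\<close> has colour \<open>c\<close>.

  The apices have disjoint lists of size 7, and each of the 49 pairs of apex colours is defeated by
  its own block of six spine vertices, whose lists consist of that pair and five further colours.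
  Between consecutive spine vertices there are two palettes, one on each side. They can be chosen
  so that 3 possible colours of one vertex leave only 2 for the next, 2 leave only 1, and 1 leaves
  none. Hence three colours of a central spine vertex are eliminated by going right, and the other
  two by going left.\<close>

section \<open>Graphs on the natural numbers from relations on countable types\<close>

text \<open>The theorem fixes \<open>nat\<close> as vertex type, while a structured datatype is
  easier to argue about, hence the encoding. \<open>A\<close> may list each edge in one direction
  only; adding the converse gives both arcs.\<close>

definition nat_graph :: "'a::countable set \<Rightarrow> ('a \<times> 'a) set \<Rightarrow> (nat, nat \<times> nat) pre_digraph" where
  "nat_graph V A = \<lparr>verts = to_nat ` V, arcs = map_prod to_nat to_nat ` (A \<union> A\<inverse>),
     tail = fst, head = snd\<rparr>"

lemma nat_graph_simps [simp]:
  "verts (nat_graph V A) = to_nat ` V"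
  "arcs (nat_graph V A) = map_prod to_nat to_nat ` (A \<union> A\<inverse>)"
  "tail (nat_graph V A) = fst"
  "head (nat_graph V A) = snd"
  by (simp_all add: nat_graph_def)

lemma arcs_ends_nat_graph: "arcs_ends (nat_graph V A) = map_prod to_nat to_nat ` (A \<union> A\<inverse>)"
  by (simp add: arcs_ends_def arc_to_ends_def)

lemma edges_nat_graph: "edges (nat_graph V A) = {to_nat ` {s, t} | s t. (s, t) \<in> A}"
proof -
  have "u \<rightarrow>\<^bsub>nat_graph V A\<^esub> v \<longleftrightarrow>
      (\<exists>s t. u = to_nat s \<and> v = to_nat t \<and> ((s, t) \<in> A \<or> (t, s) \<in> A))" for u v
    unfolding arcs_ends_nat_graph by (auto intro!: image_eqI[where x = "(_, _)"])
  then have "edges (nat_graph V A) = {{to_nat s, to_nat t} | s t. (s, t) \<in> A \<or> (t, s) \<in> A}"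
    unfolding edges_def by auto
  also have "\<dots> = {to_nat ` {s, t} | s t. (s, t) \<in> A}"
  proof (intro equalityI subsetI)
    fix e assume "e \<in> {{to_nat s, to_nat t} | s t. (s, t) \<in> A \<or> (t, s) \<in> A}"
    then obtain s t where "e = to_nat ` {s, t}" "e = to_nat ` {t, s}" "(s, t) \<in> A \<or> (t, s) \<in> A"
      by (auto simp: insert_commute)
    then show "e \<in> {to_nat ` {s, t} | s t. (s, t) \<in> A}"
      by blast
  qed auto
  finally show ?thesis .
qed

lemma out_degree_nat_graph:
  fixes v :: "'a::countable"
  shows "out_degree (nat_graph V A) (to_nat v) = card ((A \<union> A\<inverse>) `` {v})"
proof -
  have "out_arcs (nat_graph V A) (to_nat v)
      = (\<lambda>t. (to_nat v, to_nat t)) ` ((A \<union> A\<inverse>) `` {v})"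
    by (auto simp: out_arcs_def)
  moreover have "inj_on (\<lambda>t. (to_nat v, to_nat (t :: 'a))) X" for X
    by (auto simp: inj_on_def)
  ultimately show ?thesis
    by (simp add: out_degree_def card_image)
qed

lemma graph_nat_graph:
  assumes "finite V" "A \<subseteq> V \<times> V" "\<And>s. (s, s) \<notin> A"
  shows "graph (nat_graph V A)"
proof -
  have "finite (A \<union> A\<inverse>)"
    using assms finite_subset[OF assms(2)] by simp
  moreover have "symmetric (nat_graph V A)"
    unfolding symmetric_def arcs_ends_nat_graph by (auto simp: sym_def)
  ultimately show ?thesis
    using assms by unfold_locales (auto simp: arc_to_ends_def)
qed

text \<open>Adjacency is symmetric, so paths from every vertex to one hub \<open>h\<close> compose
  to paths between any two vertices.\<close>

lemma connected_induced_nat_graph: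
  fixes V :: "'a::countable set"
  assumes "h \<in> T" and reach: "\<And>v. v \<in> T \<Longrightarrow> (v, h) \<in> (Restr (A \<union> A\<inverse>) T)\<^sup>*"
  shows "Digraph_Component.connected (nat_graph V A \<restriction> (to_nat ` T))"
proof -
  let ?G = "nat_graph V A \<restriction> (to_nat ` T)"
  let ?R = "Restr (A \<union> A\<inverse>) T"
  have arc: "(to_nat s, to_nat t) \<in> (arcs_ends ?G)\<^sup>s" if "(s, t) \<in> ?R" for s t
    using that by (auto simp: arcs_ends_def arc_to_ends_def induce_subgraph_def symcl_def
        intro!: image_eqI[where x = "(_, _)"])
  have "(u, v) \<in> ?R\<^sup>* \<Longrightarrow> u \<in> T \<Longrightarrow>
      (to_nat u, to_nat v) \<in> rtrancl_on (to_nat ` T) ((arcs_ends ?G)\<^sup>s)" for u v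
  proof (induction rule: rtrancl_induct)
    case base
    then show ?case by (simp add: rtrancl_on.rtrancl_on_refl)
  next
    case (step y z)
    then have "(to_nat y, to_nat z) \<in> (arcs_ends ?G)\<^sup>s" "z \<in> T"
      using arc by auto
    with step show ?case
      by (auto intro: rtrancl_on_into_rtrancl_on)
  qed
  moreover have "(u, v) \<in> ?R\<^sup>*" if "u \<in> T" "v \<in> T" for u v
  proof -
    have "sym ?R" by (auto simp: sym_def)
    then have "(h, v) \<in> ?R\<^sup>*"
      using reach[OF \<open>v \<in> T\<close>] by (meson sym_rtrancl symD)
    then show ?thesis
      using reach[OF \<open>u \<in> T\<close>] by (meson rtrancl_trans)
  qed
  ultimately show ?thesis
    using \<open>h \<in> T\<close> unfolding connected_conv by auto
qed

lemma k_connected_nat_graph: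
  fixes V :: "'a::countable set"
  assumes "card V > k"
    and "\<And>S. S \<subseteq> V \<Longrightarrow> card S < k \<Longrightarrow>
      \<exists>h \<in> V - S. \<forall>v \<in> V - S. (v, h) \<in> (Restr (A \<union> A\<inverse>) (V - S))\<^sup>*"
  shows "k_connected k (nat_graph V A)"
  unfolding k_connected_def
proof (intro conjI allI impI)
  show "k < card (verts (nat_graph V A))"
    using assms(1) by (simp add: card_image)
next
  fix S' assume "S' \<subseteq> verts (nat_graph V A)" "card S' < k"
  then obtain S where S: "S \<subseteq> V" "S' = to_nat ` S"
    by (auto simp: subset_image_iff)
  with \<open>card S' < k\<close> have "card S < k" by (simp add: card_image)
  with S assms(2) obtain h where "h \<in> V - S"
    "\<forall>v \<in> V - S. (v, h) \<in> (Restr (A \<union> A\<inverse>) (V - S))\<^sup>*" by blast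
  then have "Digraph_Component.connected (nat_graph V A \<restriction> (to_nat ` (V - S)))"
    by (intro connected_induced_nat_graph) auto
  moreover have "to_nat ` (V - S) = verts (nat_graph V A) - S'"
    using S by (simp add: image_set_diff)
  ultimately show "Digraph_Component.connected (nat_graph V A \<restriction> (verts (nat_graph V A) - S'))"
    by simp
qed

text \<open>The label recovers from a point of the drawing the vertex or edge on which it lies, so no
  two edges have to be compared.\<close>

lemma planar_nat_graph_if_labelled:
  fixes V :: "'a::countable set" and label :: "complex \<Rightarrow> 'a set"
  assumes "A \<subseteq> V \<times> V" and irrefl: "\<And>s. (s, s) \<notin> A"
    and vertex: "\<And>v. v \<in> V \<Longrightarrow> label (p v) = {v}"
    and arc: "\<And>s t. (s, t) \<in> A \<Longrightarrow> arc (g s t)"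
    and ends: "\<And>s t. (s, t) \<in> A \<Longrightarrow> pathstart (g s t) = p s \<and> pathfinish (g s t) = p t"
    and interior: "\<And>s t x. (s, t) \<in> A \<Longrightarrow> 0 < x \<Longrightarrow> x < 1 \<Longrightarrow> label (g s t x) = {s, t}"
  shows "planar (nat_graph V A)"
proof -
  define q where "q = p \<circ> (from_nat :: nat \<Rightarrow> 'a)"
  have q [simp]: "q (to_nat v) = p v" for v by (simp add: q_def)
  \<comment> \<open>An edge \<open>e\<close> is a set of codes without orientation, so
    \<open>SOME\<close> selects a pair of \<open>A\<close> representing it, whose curve then draws
    \<open>e\<close>.\<close>
  define P where "P e st \<longleftrightarrow> st \<in> A \<and> e = to_nat ` {fst st, snd st}" for e st
  define \<gamma> where "\<gamma> e = (case SOME st. P e st of (s, t) \<Rightarrow> g s t)" for e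
  have edge: "\<exists>s t. (s, t) \<in> A \<and> e = to_nat ` {s, t} \<and> \<gamma> e = g s t"
    if e: "e \<in> edges (nat_graph V A)" for e
  proof -
    obtain s t where "(s, t) \<in> A" "e = to_nat ` {s, t}"
      using e unfolding edges_nat_graph by blast
    then have "P e (s, t)"
      by (simp add: P_def)
    then have "P e (SOME st. P e st)"
      by (rule someI)
    then show ?thesis
      by (cases "SOME st. P e st") (auto simp: P_def \<gamma>_def)
  qed
  have image: "label z = {s, t}" if st: "(s, t) \<in> A" and z: "z \<in> path_image (g s t) - {p s, p t}" for s t z
  proof -
    from z obtain x where x: "0 \<le> x" "x \<le> 1" "z = g s t x"
      by (auto simp: path_image_def)
    moreover have "x \<noteq> 0" "x \<noteq> 1"
      using z x ends[OF st] by (auto simp: pathstart_def pathfinish_def)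
    ultimately show ?thesis
      using interior[OF st, of x] by simp
  qed
  have not_vertex: "z \<notin> p ` V" if "(s, t) \<in> A" "z \<in> path_image (g s t) - {p s, p t}" for s t z
  proof
    assume "z \<in> p ` V"
    then obtain v where "z = p v" "v \<in> V"
      by blast
    then have "{s, t} = {v}"
      using image[OF that] vertex by simp
    then have "s = t"
      by (auto simp: doubleton_eq_iff)
    then show False
      using irrefl that by blast
  qed
  have "plane_drawing (nat_graph V A) q \<gamma>"
    unfolding plane_drawing_def
  proof (intro conjI ballI impI)
    show "inj_on q (verts (nat_graph V A))"
      using vertex by (auto simp: inj_on_def) (metis singleton_inject)
  next
    fix e assume "e \<in> edges (nat_graph V A)"
    then obtain s t where st: "(s, t) \<in> A" "e = to_nat ` {s, t}" "\<gamma> e = g s t"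
      using edge by blast
    then show "arc (\<gamma> e)" "{pathstart (\<gamma> e), pathfinish (\<gamma> e)} = q ` e"
      using arc ends by auto
    have "q ` e = {p s, p t}" using st by simp
    then show "(path_image (\<gamma> e) - q ` e) \<inter> q ` verts (nat_graph V A) = {}"
      using not_vertex[OF st(1)] unfolding st(3) nat_graph_simps image_image q by blast
  next
    fix e e' assume "e \<in> edges (nat_graph V A)" "e' \<in> edges (nat_graph V A)" "e \<noteq> e'"
    then obtain s t s' t' where st: "(s, t) \<in> A" "e = to_nat ` {s, t}" "\<gamma> e = g s t"
      and st': "(s', t') \<in> A" "e' = to_nat ` {s', t'}" "\<gamma> e' = g s' t'"
      using edge by meson
    have q_e: "q ` e = {p s, p t}" using st by simp
    have "{p s', p t'} \<subseteq> p ` V"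
      using st' assms(1) by auto
    have False if z: "z \<in> path_image (g s t) - {p s, p t}" "z \<in> path_image (g s' t')" for z
    proof -
      have "z \<notin> {p s', p t'}"
        using not_vertex[OF st(1) z(1)] \<open>{p s', p t'} \<subseteq> p ` V\<close> by blast
      then have "{s, t} = {s', t'}"
        using image[OF st(1) z(1)] image[OF st'(1)] z(2) by blast
      then show False
        using st st' \<open>e \<noteq> e'\<close> by simp
    qed
    then show "(path_image (\<gamma> e) - q ` e) \<inter> path_image (\<gamma> e') = {}"
      unfolding q_e st(3) st'(3) by blast
  qed
  then show ?thesis
    by (auto simp: planar_def)
qed

lemma not_truncated_degree_choosable_nat_graph:
  fixes V :: "'a::countable set" and L :: "'a \<Rightarrow> nat set"
  assumes "\<And>v. v \<in> V \<Longrightarrow> finite (L v) \<and> card (L v) \<ge> min k (card ((A \<union> A\<inverse>) `` {v}))"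
    and no: "\<And>\<phi>. (\<And>v. v \<in> V \<Longrightarrow> \<phi> v \<in> L v) \<Longrightarrow> (\<And>s t. (s, t) \<in> A \<Longrightarrow> \<phi> s \<noteq> \<phi> t) \<Longrightarrow> False"
  shows "\<not> truncated_degree_choosable k (nat_graph V A)"
proof
  let ?G = "nat_graph V A"
  assume "truncated_degree_choosable k ?G"
  moreover have "\<forall>v \<in> verts ?G. finite (L (from_nat v)) \<and>
      card (L (from_nat v)) \<ge> min k (out_degree ?G v)"
    using assms(1) by (auto simp: out_degree_nat_graph)
  ultimately obtain \<phi> where \<phi>: "\<forall>v \<in> verts ?G. \<phi> v \<in> L (from_nat v)"
    "\<forall>u v. u \<rightarrow>\<^bsub>?G\<^esub> v \<longrightarrow> \<phi> u \<noteq> \<phi> v"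
    unfolding truncated_degree_choosable_def choosable_def
    by (elim allE[of _ "\<lambda>v. L (from_nat v)"]) auto
  show False
  proof (rule no[of "\<phi> \<circ> to_nat"])
    show "(\<phi> \<circ> to_nat) v \<in> L v" if "v \<in> V" for v
      using \<phi>(1) that by auto
    show "(\<phi> \<circ> to_nat) s \<noteq> (\<phi> \<circ> to_nat) t" if "(s, t) \<in> A" for s t
      using \<phi>(2) that by (force simp: arcs_ends_nat_graph)
  qed
qed

section \<open>The graph\<close>

text \<open>The Boolean argument selects the apex; \<open>Outer s i\<close> and \<open>Inner s i\<close> lie in the triangle
  \<open>Apex s\<close>, \<open>Spine i\<close>, \<open>Spine (Suc i)\<close>.\<close>

datatype vtx = Apex bool | Spine nat | Outer bool nat | Inner bool nat

instance vtx :: countable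
  by countable_datatype

definition strip_verts :: "nat \<Rightarrow> vtx set" where
  "strip_verts n = range Apex \<union> Spine ` {..<n} \<union>
     (\<Union>s. Outer s ` {..<n - 1}) \<union> (\<Union>s. Inner s ` {..<n - 1})"

text \<open>Every edge is listed once, with an apex only in second place; \<open>strip_curve\<close>
  relies on this.\<close>

inductive_set strip_edges :: "nat \<Rightarrow> (vtx \<times> vtx) set" for n where
  spine: "Suc i < n \<Longrightarrow> (Spine i, Spine (Suc i)) \<in> strip_edges n"
| spine_apex: "i < n \<Longrightarrow> (Spine i, Apex s) \<in> strip_edges n"
| outer_apex: "Suc i < n \<Longrightarrow> (Outer s i, Apex s) \<in> strip_edges n"
| left_outer: "Suc i < n \<Longrightarrow> (Spine i, Outer s i) \<in> strip_edges n"
| right_outer: "Suc i < n \<Longrightarrow> (Spine (Suc i), Outer s i) \<in> strip_edges n"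
| left_inner: "Suc i < n \<Longrightarrow> (Spine i, Inner s i) \<in> strip_edges n"
| right_inner: "Suc i < n \<Longrightarrow> (Spine (Suc i), Inner s i) \<in> strip_edges n"
| inner_outer: "Suc i < n \<Longrightarrow> (Inner s i, Outer s i) \<in> strip_edges n"

abbreviation strip_graph :: "nat \<Rightarrow> (nat, nat \<times> nat) pre_digraph" where
  "strip_graph n \<equiv> nat_graph (strip_verts n) (strip_edges n)"

lemma in_strip_verts [simp]:
  "Apex s \<in> strip_verts n"
  "Spine i \<in> strip_verts n \<longleftrightarrow> i < n"
  "Outer s i \<in> strip_verts n \<longleftrightarrow> Suc i < n"
  "Inner s i \<in> strip_verts n \<longleftrightarrow> Suc i < n"
  by (auto simp: strip_verts_def image_iff less_diff_conv)

lemma finite_strip_verts: "finite (strip_verts n)"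
  by (simp add: strip_verts_def)

lemma strip_edges_subset: "strip_edges n \<subseteq> strip_verts n \<times> strip_verts n"
  by (auto elim: strip_edges.cases)

lemma strip_edges_irrefl: "(s, s) \<notin> strip_edges n"
  by (auto elim: strip_edges.cases)

lemma graph_strip_graph: "graph (strip_graph n)"
  by (intro graph_nat_graph finite_strip_verts strip_edges_subset strip_edges_irrefl)

section \<open>Non-completeness and 3-connectivity\<close>

lemma not_complete_strip_graph: "\<not> complete_graph (strip_graph n)"
proof
  assume "complete_graph (strip_graph n)"
  then have "arcs_ends (strip_graph n)
      = {(u, v). (u, v) \<in> verts (strip_graph n) \<times> verts (strip_graph n) \<and> u \<noteq> v}"
    by (auto simp: complete_graph_def complete_digraph_def)
  then have "(to_nat (Apex True), to_nat (Apex False)) \<in> arcs_ends (strip_graph n)"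
    by auto
  then show False
    by (auto simp: arcs_ends_nat_graph elim: strip_edges.cases)
qed

text \<open>A surviving apex is a hub adjacent to the whole spine. If no apex survives, the two
  deleted vertices are the apices and the spine is an intact path.\<close>

lemma k_connected_strip_graph:
  assumes "n \<ge> 4"
  shows "k_connected 3 (strip_graph n)"
proof (rule k_connected_nat_graph)
  have "card (Spine ` {..<n}) \<le> card (strip_verts n - {Apex True})"
    using finite_strip_verts by (intro card_mono) auto
  then show "3 < card (strip_verts n)"
    using assms finite_strip_verts by (simp add: card_image inj_on_def)
next
  fix S assume S: "S \<subseteq> strip_verts n" "card S < 3"
  define T where "T = strip_verts n - S"
  define R where "R = Restr (strip_edges n \<union> (strip_edges n)\<inverse>) T"
  have finS: "finite S"
    using S finite_strip_verts finite_subset by blast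
  have out: "c \<notin> S" if "a \<in> S" "b \<in> S" "a \<noteq> b" "c \<noteq> a" "c \<noteq> b" for a b c
  proof
    assume "c \<in> S"
    then have "card {a, b, c} \<le> card S"
      using that finS by (intro card_mono) auto
    with that S show False by simp
  qed
  have edge: "(s, t) \<in> R\<^sup>*" "(t, s) \<in> R\<^sup>*"
    if "(s, t) \<in> strip_edges n" "s \<notin> S" "t \<notin> S" for s t
    using that strip_edges_subset by (auto simp: R_def T_def)
  \<comment> \<open>It suffices to link the spine to \<open>h\<close>. Apices, outer and inner
    vertices follow in this order: each has three neighbours treated earlier, and \<open>S\<close>
    cannot contain all three.\<close>
  have reach: "\<exists>h \<in> T. \<forall>v \<in> T. (v, h) \<in> R\<^sup>*"
    if h: "h \<in> T" and spine: "\<And>i. i < n \<Longrightarrow> Spine i \<notin> S \<Longrightarrow> (Spine i, h) \<in> R\<^sup>*" for h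
  proof (intro bexI[OF _ h] ballI)
    have apex: "(Apex s, h) \<in> R\<^sup>*" if "Apex s \<notin> S" for s
    proof -
      obtain i where "i < 3" "Spine i \<notin> S"
        using out[of "Spine 0" "Spine 1" "Spine 2"] that(1)[of 0] that(1)[of 1] that(1)[of 2] by auto
      then show ?thesis
        using assms that spine[of i] edge(2)[OF spine_apex[of i n s]] by (auto intro: rtrancl_trans)
    qed
    have outer: "(Outer s i, h) \<in> R\<^sup>*" if "Outer s i \<notin> S" "Suc i < n" for s i
    proof -
      consider "Spine i \<notin> S" | "Spine (Suc i) \<notin> S" | "Apex s \<notin> S"
        using out[of "Spine i" "Spine (Suc i)" "Apex s"] by auto
      then show ?thesis
        using that edge(2)[OF left_outer, of i s] edge(2)[OF right_outer, of i s]
          edge(1)[OF outer_apex, of i s] spine[of i] spine[of "Suc i"] apex[of s]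
        by cases (auto intro: rtrancl_trans)
    qed
    have inner: "(Inner s i, h) \<in> R\<^sup>*" if "Inner s i \<notin> S" "Suc i < n" for s i
    proof -
      consider "Spine i \<notin> S" | "Spine (Suc i) \<notin> S" | "Outer s i \<notin> S"
        using out[of "Spine i" "Spine (Suc i)" "Outer s i"] by auto
      then show ?thesis
        using that edge(2)[OF left_inner, of i s] edge(2)[OF right_inner, of i s]
          edge(1)[OF inner_outer, of i s] spine[of i] spine[of "Suc i"] outer[of s i]
        by cases (auto intro: rtrancl_trans)
    qed
    show "(v, h) \<in> R\<^sup>*" if "v \<in> T" for v
      using that spine apex outer inner by (cases v) (auto simp: T_def)
  qed
  have "\<exists>h \<in> T. \<forall>v \<in> T. (v, h) \<in> R\<^sup>*"
  proof (cases "\<exists>s. Apex s \<notin> S")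
    case True
    then obtain s where "Apex s \<notin> S" ..
    then show ?thesis
      using edge(1)[OF spine_apex, of _ s] by (intro reach[of "Apex s"]) (auto simp: T_def)
  next
    case False
    then have "Spine i \<notin> S" for i
      using out[of "Apex True" "Apex False" "Spine i"] by simp
    then have "(Spine i, Spine 0) \<in> R\<^sup>*" if "i < n" for i
      using that
    proof (induction i)
      case (Suc i)
      then show ?case
        using edge(2)[OF strip_edges.spine, of i] by (auto intro: rtrancl_trans)
    qed simp
    then show ?thesis
      using assms \<open>\<And>i. Spine i \<notin> S\<close> by (intro reach[of "Spine 0"]) (auto simp: T_def)
  qed
  then show "\<exists>h \<in> strip_verts n - S. \<forall>v \<in> strip_verts n - S.
      (v, h) \<in> (Restr (strip_edges n \<union> (strip_edges n)\<inverse>) (strip_verts n - S))\<^sup>*"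
    by (simp only: R_def T_def)
qed

section \<open>A plane drawing\<close>

text \<open>The apices are the points \<open>\<i>\<close> and \<open>-\<i>\<close>; the map below contracts the horizontal lines at heights
  1 and -1 to them, and is injective in between. In the coordinates \<open>(t, h)\<close> all edges are
  straight, and those ending in an apex are vertical.\<close>

definition pt :: "real \<Rightarrow> real \<Rightarrow> complex" where
  "pt t h = Complex (t * (1 - \<bar>h\<bar>)) h"

definition curve :: "real \<Rightarrow> real \<Rightarrow> real \<Rightarrow> real \<Rightarrow> real \<Rightarrow> complex" where
  "curve t h t' h' = (\<lambda>x. pt (t + x * (t' - t)) (h + x * (h' - h)))"

lemma pt_eq_iff: "pt t h = pt t' h' \<longleftrightarrow> h = h' \<and> (\<bar>h\<bar> = 1 \<or> t = t')"
  by (auto simp: pt_def complex_eq_iff)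

text \<open>If the heights differ, the height determines the parameter; otherwise the curve is
  horizontal at a height where \<open>pt\<close> is injective in the abscissa.\<close>

lemma arc_curve:
  assumes "\<bar>h\<bar> \<noteq> 1" "t \<noteq> t' \<or> h \<noteq> h'"
  shows "arc (curve t h t' h')"
  unfolding arc_def path_def
proof
  show "continuous_on {0..1} (curve t h t' h')"
    unfolding curve_def pt_def complex_eq_iff Complex_eq by (intro continuous_intros)
  show "inj_on (curve t h t' h') {0..1}"
  proof (rule inj_onI)
    fix x y
    assume "curve t h t' h' x = curve t h t' h' y"
    then have "x * (h' - h) = y * (h' - h)"
      "\<bar>h + x * (h' - h)\<bar> = 1 \<or> x * (t' - t) = y * (t' - t)"
      by (auto simp: curve_def pt_eq_iff)
    then show "x = y"
      using assms by (cases "h = h'") auto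
  qed
qed

definition side :: "bool \<Rightarrow> real" where
  "side s = (if s then 1 else - 1)"

fun abscissa :: "vtx \<Rightarrow> real" where
  "abscissa (Apex s) = 0"
| "abscissa (Spine i) = i"
| "abscissa (Outer s i) = i + 1 / 2"
| "abscissa (Inner s i) = i + 1 / 2"

fun height :: "vtx \<Rightarrow> real" where
  "height (Apex s) = side s"
| "height (Spine i) = 0"
| "height (Outer s i) = side s / 2"
| "height (Inner s i) = side s / 4"

text \<open>All abscissae at height 1 or -1 give the same point, so a curve to an apex can keep the
  abscissa of \<open>u\<close> and be vertical.\<close>

definition strip_curve :: "vtx \<Rightarrow> vtx \<Rightarrow> real \<Rightarrow> complex" where
  "strip_curve u v = curve (abscissa u) (height u)
     (case v of Apex s \<Rightarrow> abscissa u | _ \<Rightarrow> abscissa v) (height v)"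

text \<open>Here \<open>f\<close> is the horizontal offset from \<open>Spine i\<close>. Slanted
  edges at outer vertices satisfy \<open>\<bar>h\<bar> = f\<close> or
  \<open>\<bar>h\<bar> = 1 - f\<close>; those at inner vertices are half as steep. Points on no edge
  get arbitrary labels.\<close>

definition cell_label :: "nat \<Rightarrow> real \<Rightarrow> real \<Rightarrow> vtx set" where
  "cell_label i f h = (let s = h > 0 in
     if h = 0 then (if f = 0 then {Spine i} else {Spine i, Spine (Suc i)})
     else if f = 0 then {Spine i, Apex s}
     else if f = 1 / 2 then
       (if \<bar>h\<bar> = 1 / 4 then {Inner s i}
        else if \<bar>h\<bar> = 1 / 2 then {Outer s i}
        else if \<bar>h\<bar> < 1 / 2 then {Inner s i, Outer s i}
        else {Outer s i, Apex s})
     else if f < 1 / 2 then {Spine i, if \<bar>h\<bar> = f then Outer s i else Inner s i}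
     else {Spine (Suc i), if \<bar>h\<bar> = 1 - f then Outer s i else Inner s i})"

definition label :: "complex \<Rightarrow> vtx set" where
  "label z = (let h = Im z; t = Re z / (1 - \<bar>h\<bar>) in
     if \<bar>h\<bar> = 1 then {Apex (h > 0)} else cell_label (nat \<lfloor>t\<rfloor>) (frac t) h)"

lemma label_pt:
  assumes "t = real i + f" "0 \<le> f" "f < 1" "\<bar>h\<bar> \<noteq> 1"
  shows "label (pt t h) = cell_label i f h"
proof -
  have "\<lfloor>t\<rfloor> = int i"
    using assms by (intro floor_unique) auto
  then show ?thesis
    using assms by (simp add: label_def pt_def frac_def)
qed

lemma label_strip_vertex: "label (pt (abscissa v) (height v)) = {v}"
proof (cases v)
  case (Apex s)
  then show ?thesis by (simp add: label_def pt_def side_def)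
next
  case (Spine i)
  then show ?thesis by (simp add: label_pt[of _ i 0] cell_label_def)
next
  case (Outer s i)
  then show ?thesis by (simp add: label_pt[of _ i "1 / 2"] cell_label_def side_def)
next
  case (Inner s i)
  then show ?thesis by (simp add: label_pt[of _ i "1 / 2"] cell_label_def side_def)
qed

text \<open>The last argument given to \<open>label_pt\<close> is the offset at parameter
  \<open>x\<close>; edges from \<open>Spine (Suc i)\<close> run leftwards, hence
  \<open>1 - x / 2\<close>.\<close>

lemma label_strip_curve:
  assumes "(u, v) \<in> strip_edges n" "0 < x" "x < 1"
  shows "label (strip_curve u v x) = {u, v}"
  using assms(1)
proof cases
  case (spine i)
  then show ?thesis
    using assms by (simp add: strip_curve_def curve_def label_pt[of _ i x] cell_label_def)
next
  case (spine_apex i s)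
  then show ?thesis
    using assms by (simp add: strip_curve_def curve_def label_pt[of _ i 0] cell_label_def side_def)
next
  case (outer_apex i s)
  then show ?thesis
    using assms
    by (simp add: strip_curve_def curve_def label_pt[of _ i "1 / 2"] cell_label_def side_def)
next
  case (left_outer i s)
  then show ?thesis
    using assms
    by (simp add: strip_curve_def curve_def label_pt[of _ i "x / 2"] cell_label_def side_def)
next
  case (right_outer i s)
  then show ?thesis
    using assms
    by (simp add: strip_curve_def curve_def label_pt[of _ i "1 - x / 2"] cell_label_def side_def)
next
  case (left_inner i s)
  then show ?thesis
    using assms
    by (simp add: strip_curve_def curve_def label_pt[of _ i "x / 2"] cell_label_def side_def)
next
  case (right_inner i s)
  then show ?thesis
    using assms
    by (simp add: strip_curve_def curve_def label_pt[of _ i "1 - x / 2"] cell_label_def side_def)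
next
  case (inner_outer i s)
  then show ?thesis
    using assms
    by (simp add: strip_curve_def curve_def label_pt[of _ i "1 / 2"] cell_label_def side_def)
qed

lemma planar_strip_graph: "planar (strip_graph n)"
proof (rule planar_nat_graph_if_labelled[OF strip_edges_subset strip_edges_irrefl])
  show "label (pt (abscissa v) (height v)) = {v}" for v
    by (rule label_strip_vertex)
  show "arc (strip_curve u v)" if "(u, v) \<in> strip_edges n" for u v
    using that unfolding strip_curve_def by cases (auto intro!: arc_curve simp: side_def)
  show "pathstart (strip_curve u v) = pt (abscissa u) (height u) \<and>
      pathfinish (strip_curve u v) = pt (abscissa v) (height v)" if "(u, v) \<in> strip_edges n" for u v
    using that by cases
      (auto simp: strip_curve_def curve_def pathstart_def pathfinish_def pt_eq_iff side_def)
  show "label (strip_curve u v x) = {u, v}" if "(u, v) \<in> strip_edges n" "0 < x" "x < 1" for u v x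
    using that by (rule label_strip_curve)
qed

section \<open>The lists\<close>

text \<open>A block consists of six consecutive spine vertices; position \<open>j\<close> means the strip between
  the \<open>j\<close>-th and the next spine vertex. Position 5 only links two blocks.\<close>

definition palette :: "bool \<Rightarrow> nat \<Rightarrow> nat set" where
  "palette s j = (if j = 2 then {0, 1, 2}
     else if j = 1 \<or> j = 3 then (if s then {0, 3, 4} else {1, 3, 4})
     else (if s then {0, 1, 2} else {2, 3, 4}))"

text \<open>The base 7 digits of \<open>k < 49\<close> enumerate all 49 pairs of apex
  colours.\<close>

definition target :: "bool \<Rightarrow> nat \<Rightarrow> nat" where
  "target s k = (if s then 5 + k div 7 else 12 + k mod 7)"

fun lists :: "vtx \<Rightarrow> nat set" where
  "lists (Apex s) = (if s then {5..<12} else {12..<19})"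
| "lists (Spine i) = {target True (i div 6), target False (i div 6)} \<union> {..<5}"
| "lists (Outer s i) = insert (target s (i div 6)) (palette s (i mod 6))"
| "lists (Inner s i) = palette s (i mod 6)"

lemma palette: "finite (palette s j)" "card (palette s j) = 3" "palette s j \<subseteq> {..<5}"
  by (auto simp: palette_def)

lemma target_ge: "target s k \<ge> 5"
  by (simp add: target_def)

text \<open>Apices and spine vertices have 7 colours, so their degrees do not matter; outer and
  inner vertices have degree at most 4 and 3. The spine length is 294 = 6 * 49.\<close>

lemma lists_large:
  assumes "v \<in> strip_verts 294"
  shows "finite (lists v) \<and>
    card (lists v) \<ge> min 7 (card ((strip_edges 294 \<union> (strip_edges 294)\<inverse>) `` {v}))"
    (is "_ \<and> _ \<ge> min 7 (card (?N v))")
proof (cases v)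
  case (Apex s)
  then show ?thesis by simp
next
  case (Spine i)
  then have "i < 294" using assms by simp
  \<comment> \<open>The two targets are thus distinct, and both lie outside
    \<open>{..<5}\<close>.\<close>
  then have "target True (i div 6) < 12" "target False (i div 6) \<ge> 12"
    by (auto simp: target_def)
  then have "card (lists v) = 7"
    using Spine target_ge[of True "i div 6"] by simp
  then show ?thesis using Spine by simp
next
  case (Outer s i)
  have "?N v \<subseteq> {Apex s, Spine i, Spine (Suc i), Inner s i}"
    using Outer by (auto elim: strip_edges.cases)
  then have "card (?N v) \<le> 4"
    using card_mono[of "{Apex s, Spine i, Spine (Suc i), Inner s i}" "?N v"] by simp
  moreover have "target s (i div 6) \<notin> palette s (i mod 6)"
    using palette(3) target_ge leD by fastforce
  ultimately show ?thesis
    using Outer by (simp add: palette)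
next
  case (Inner s i)
  have "?N v \<subseteq> {Spine i, Spine (Suc i), Outer s i}"
    using Inner by (auto elim: strip_edges.cases)
  then have "card (?N v) \<le> 3"
    using card_mono[of "{Spine i, Spine (Suc i), Outer s i}" "?N v"] by simp
  then show ?thesis
    using Inner by (simp add: palette)
qed

section \<open>Impossibility of a colouring from the lists\<close>

text \<open>Otherwise four pairwise adjacent vertices would be coloured from a three-element palette.\<close>

lemma spine_colours_not_both_in_palette:
  assumes list: "\<And>v. v \<in> strip_verts n \<Longrightarrow> \<phi> v \<in> lists v"
    and proper: "\<And>u v. (u, v) \<in> strip_edges n \<Longrightarrow> \<phi> u \<noteq> \<phi> v"
    and "Suc i < n" and apex: "\<phi> (Apex s) = target s (i div 6)"
  shows "\<not> (\<phi> (Spine i) \<in> palette s (i mod 6) \<and> \<phi> (Spine (Suc i)) \<in> palette s (i mod 6))"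
proof
  let ?P = "palette s (i mod 6)"
  assume spine: "\<phi> (Spine i) \<in> ?P \<and> \<phi> (Spine (Suc i)) \<in> ?P"
  have "\<phi> (Outer s i) \<noteq> target s (i div 6)"
    using proper[OF outer_apex[of i n s]] apex \<open>Suc i < n\<close> by simp
  then have "\<phi> (Outer s i) \<in> ?P" "\<phi> (Inner s i) \<in> ?P"
    using list[of "Outer s i"] list[of "Inner s i"] \<open>Suc i < n\<close> by auto
  then have "card {\<phi> (Spine i), \<phi> (Spine (Suc i)), \<phi> (Inner s i), \<phi> (Outer s i)} \<le> card ?P"
    using spine palette by (intro card_mono) auto
  moreover have "card {\<phi> (Spine i), \<phi> (Spine (Suc i)), \<phi> (Inner s i), \<phi> (Outer s i)} = 4"
    using proper strip_edges.spine[OF \<open>Suc i < n\<close>] left_outer[OF \<open>Suc i < n\<close>, of s]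
      right_outer[OF \<open>Suc i < n\<close>, of s] left_inner[OF \<open>Suc i < n\<close>, of s]
      right_inner[OF \<open>Suc i < n\<close>, of s] inner_outer[OF \<open>Suc i < n\<close>, of s] by simp
  ultimately show False
    by (simp add: palette)
qed

text \<open>The colours 3 and 4 of the vertex 2 leave only colour 2 for vertex 1 and then none for
  vertex 0. Its colours 0, 1 and 2 leave only 3 and 4 for vertex 3, then 2 for vertex 4, and then
  none for vertex 5.\<close>

lemma no_block_colouring:
  fixes x :: "nat \<Rightarrow> nat"
  assumes "\<And>j. j < 6 \<Longrightarrow> x j < 5"
    and palette: "\<And>j s. j < 5 \<Longrightarrow> \<not> (x j \<in> palette s j \<and> x (Suc j) \<in> palette s j)"
  shows False
proof -
  have range: "x j \<in> {0, 1, 2, 3, 4}" if "j < 6" for j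
    using assms(1)[OF that] by auto
  have "x 2 \<notin> {3, 4}"
  proof
    assume "x 2 \<in> {3, 4}"
    then have "x 1 = 2"
      using range[of 1] palette[of 1 True] palette[of 1 False]
      by (auto simp: palette_def numeral_2_eq_2)
    then show False
      using range[of 0] palette[of 0 True] palette[of 0 False] by (auto simp: palette_def)
  qed
  then have "x 2 \<in> {0, 1, 2}"
    using range[of 2] by auto
  then have "x 3 \<in> {3, 4}"
    using range[of 3] palette[of 2 True] by (auto simp: palette_def)
  then have "x 4 = 2"
    using range[of 4] palette[of 3 True] palette[of 3 False] by (auto simp: palette_def)
  then show False
    using range[of 5] palette[of 4 True] palette[of 4 False] by (auto simp: palette_def)
qed

lemma no_strip_colouring:
  assumes list: "\<And>v. v \<in> strip_verts 294 \<Longrightarrow> \<phi> v \<in> lists v"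
    and proper: "\<And>u v. (u, v) \<in> strip_edges 294 \<Longrightarrow> \<phi> u \<noteq> \<phi> v"
  shows False
proof -
  have "\<phi> (Apex True) \<in> {5..<12}" "\<phi> (Apex False) \<in> {12..<19}"
    using list[of "Apex True"] list[of "Apex False"] by simp_all
  then obtain a b where ab: "\<phi> (Apex True) = 5 + a" "\<phi> (Apex False) = 12 + b" "a < 7" "b < 7"
    by (auto simp: le_iff_add)
  \<comment> \<open>This is the block whose target pair is exactly the pair of colours used on the
    apices.\<close>
  define k where "k = 7 * a + b"
  have "k < 49" and apex: "\<phi> (Apex s) = target s k" for s
    using ab by (auto simp: k_def target_def)
  show False
  proof (rule no_block_colouring[of "\<lambda>j. \<phi> (Spine (6 * k + j))"])
    fix j :: nat
    assume "j < 6"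
    then have "6 * k + j < 294" "(6 * k + j) div 6 = k"
      using \<open>k < 49\<close> by auto
    \<comment> \<open>Adjacency to both apices rules out both targets, leaving only the five colours
      below 5.\<close>
    moreover have "\<phi> (Spine (6 * k + j)) \<noteq> target s k" for s
      using proper[OF spine_apex] apex \<open>6 * k + j < 294\<close> by metis
    ultimately show "\<phi> (Spine (6 * k + j)) < 5"
      using list[of "Spine (6 * k + j)"] by auto
  next
    fix j :: nat and s
    assume "j < 5"
    then have "Suc (6 * k + j) < 294" "(6 * k + j) div 6 = k" "(6 * k + j) mod 6 = j"
      using \<open>k < 49\<close> by auto
    then show "\<not> (\<phi> (Spine (6 * k + j)) \<in> palette s j \<and> \<phi> (Spine (6 * k + Suc j)) \<in> palette s j)"
      using spine_colours_not_both_in_palette[of 294 \<phi> "6 * k + j" s] list proper apex by simp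
  qed
qed

theorem theorem3:
  shows "\<exists>G :: (nat, nat \<times> nat) pre_digraph.
    graph G \<and> k_connected 3 G \<and> \<not> complete_graph G \<and> planar G \<and>
    \<not> truncated_degree_choosable 7 G"
proof (intro exI conjI)
  show "graph (strip_graph 294)"
    by (rule graph_strip_graph)
  show "k_connected 3 (strip_graph 294)"
    by (rule k_connected_strip_graph) simp
  show "\<not> complete_graph (strip_graph 294)"
    by (rule not_complete_strip_graph)
  show "planar (strip_graph 294)"
    by (rule planar_strip_graph)
  show "\<not> truncated_degree_choosable 7 (strip_graph 294)"
    using lists_large no_strip_colouring by (rule not_truncated_degree_choosable_nat_graph)
qed

end
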